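(* Let $G$ be a simple connected graph with $|E(G)|\ge1$ and let $v\in V(G)$. Let $\bar G$ be obtained from $G$ by attaching three new pendant vertices $a,b,c$ to $v$, and let $\widehat G=\bar G+\{a,b\}+\{b,c\}$. Then $\mathscr{K}(\widehat G)>\mathscr{K}(\bar G)$.
   Context: For connected $H$ with $m\ge1$ edges and degrees $d_i$, Kemeny's constant is $\mathscr{K}(H)=\sum_j\pi_jm_{ij}$ for the simple random walk on $H$ ($\pi_j=d_j/2m$, $m_{ij}$ expected hitting time of $j$ from $i$, $m_{jj}=0$), equivalently $\frac1{4m}\sum_{i,j}d_id_jr_H(i,j)$ with $r_H$ effective resistance. $H+\{x,y\}$ denotes $H$ with the edge $\{x,y\}$ added. *)

theory Defs
  imports "HOL-Probability.Probability" "Graph_Theory.Graph_Theory"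
begin

text \<open>
  A finite simple undirected graph is a \<open>pair_graph\<close>: a finite vertex set with a finite,
  symmetric, loop-free set of arcs. Each undirected edge is represented by its two opposite arcs.
\<close>

definition uedges :: "'a pair_pre_digraph \<Rightarrow> 'a set set" where
  "uedges H = {{x, y} | x y. (x, y) \<in> parcs H}"

definition add_edge :: "'a pair_pre_digraph \<Rightarrow> 'a \<Rightarrow> 'a \<Rightarrow> 'a pair_pre_digraph" where
  "add_edge H x y = \<lparr>pverts = pverts H, parcs = parcs H \<union> {(x, y), (y, x)}\<rparr>"

text \<open>This yields a pendant vertex only when \<open>p\<close> is not already a vertex of \<open>H\<close>.\<close>

definition attach_pendant :: "'a pair_pre_digraph \<Rightarrow> 'a \<Rightarrow> 'a \<Rightarrow> 'a pair_pre_digraph" where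
  "attach_pendant H v p = add_edge \<lparr>pverts = insert p (pverts H), parcs = parcs H\<rparr> v p"

text \<open>
  The law of step \<open>n\<close> of the simple random walk started at \<open>x\<close>, given the trajectory \<open>\<omega>\<close> before
  step \<open>n\<close>: the walk starts deterministically and then moves to a uniformly random neighbour.
\<close>

definition walk_kernel ::
    "'a pair_pre_digraph \<Rightarrow> 'a \<Rightarrow> nat \<Rightarrow> (nat \<Rightarrow> 'a) \<Rightarrow> 'a measure" where
  "walk_kernel H x n \<omega> =
     measure_pmf (if n = 0 then return_pmf x else pmf_of_set (parcs H `` {\<omega> (n - 1)}))"

lemma Ionescu_Tulcea_walk_kernel:
  "Ionescu_Tulcea (walk_kernel H x) (\<lambda>_. count_space UNIV)"
proof (rule Ionescu_Tulcea.intro)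
  fix n :: nat
  show "walk_kernel H x n \<in> PiM {0..<n} (\<lambda>_. count_space UNIV) \<rightarrow>\<^sub>M subprob_algebra (count_space UNIV)"
  proof (cases n)
    case 0
    then show ?thesis
      by (auto simp: walk_kernel_def[abs_def] intro!: measurable_const measure_pmf_in_subprob_algebra)
  next
    case (Suc k)
    have "(\<lambda>y. measure_pmf (pmf_of_set (parcs H `` {y})))
            \<in> count_space UNIV \<rightarrow>\<^sub>M subprob_algebra (count_space UNIV)"
      by (auto intro: measure_pmf_in_subprob_algebra)
    moreover have "(\<lambda>\<omega>. \<omega> k) \<in> PiM {0..<n} (\<lambda>_. count_space UNIV) \<rightarrow>\<^sub>M count_space (UNIV :: 'a set)"
      using Suc by (intro measurable_component_singleton) auto
    ultimately show ?thesis
      using Suc by (auto simp: walk_kernel_def[abs_def] intro: measurable_compose)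
  qed
next
  show "prob_space (walk_kernel H x n \<omega>)" for n \<omega>
    by (simp add: walk_kernel_def measure_pmf.prob_space_axioms)
qed

text \<open>The law of the whole trajectory, obtained from the kernels by Ionescu-Tulcea.\<close>

definition walk_measure :: "'a pair_pre_digraph \<Rightarrow> 'a \<Rightarrow> (nat \<Rightarrow> 'a) measure" where
  "walk_measure H x =
     projective_family.lim UNIV
       (Ionescu_Tulcea.CI (walk_kernel H x) (\<lambda>_. count_space UNIV)) (\<lambda>_. count_space UNIV)"

text \<open>
  Time \<open>0\<close> counts as a visit, so the hitting time of the starting vertex is \<open>0\<close>; the value is
  \<open>\<infinity>\<close> if \<open>j\<close> is never visited.
\<close>

definition hitting_time :: "'a \<Rightarrow> (nat \<Rightarrow> 'a) \<Rightarrow> ennreal" where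
  "hitting_time j \<omega> = (INF n\<in>{n. \<omega> n = j}. of_nat n)"

definition expected_hitting_time :: "'a pair_pre_digraph \<Rightarrow> 'a \<Rightarrow> 'a \<Rightarrow> ennreal" where
  "expected_hitting_time H i j = (\<integral>\<^sup>+\<omega>. hitting_time j \<omega> \<partial>walk_measure H i)"

definition stationary :: "'a pair_pre_digraph \<Rightarrow> 'a \<Rightarrow> real" where
  "stationary H j = real (out_degree (with_proj H) j) / (2 * real (card (uedges H)))"

text \<open>
  Kemeny's constant is the common value, over all starting vertices \<open>i\<close>, of the expected time to
  hit a random target drawn from the stationary distribution.
\<close>

definition kemeny :: "'a pair_pre_digraph \<Rightarrow> ennreal" where
  "kemeny H = (THE k. \<forall>i\<in>pverts H.
     (\<Sum>j\<in>pverts H. ennreal (stationary H j) * expected_hitting_time H i j) = k)"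

end

theory Submission
  imports Defs
begin

text \<open>
  Write \<open>h\<^sub>j i\<close> for the expected hitting time of \<open>j\<close> from \<open>i\<close>, \<open>d\<close> for the degrees and \<open>D\<close> for
  their sum. On a connected graph \<open>h\<^sub>j\<close> is the only function vanishing at \<open>j\<close> whose Laplacian agrees
  with \<open>d\<close> off \<open>j\<close>, and at \<open>j\<close> its Laplacian is \<open>d j - D\<close>. Hence the average of the \<open>h\<^sub>j\<close> against
  \<open>d j / D\<close> is harmonic, so constant, and Kemeny's constant can be computed from any start vertex.

  Start at the cut vertex \<open>v\<close>. By uniqueness, the hitting times of the enlarged graphs are those of \<open>G\<close>
  corrected by the electrical potentials \<open>(h\<^sub>j i - h\<^sub>v i + h\<^sub>v j) / D\<close>, together with the solution of a
  small linear system on \<open>a, b, c\<close>. With \<open>K\<close> the constant of \<open>G\<close> and \<open>y\<close> the expected hitting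
  time of \<open>v\<close> from a stationary start in \<open>G\<close>, the constant of the graph with three pendants is
  \<open>K + (6 y + 3 (D + 5)) / (D + 6)\<close>, the other one is \<open>K + (10 y + 47/2 + 4 D) / (D + 10)\<close>, and
  after clearing denominators they differ by \<open>4 D y + (D - 2) (D + 9/2) > 0\<close>. For a single edge
  (\<open>D = 2\<close>) only \<open>y > 0\<close> makes the inequality strict.
\<close>

section \<open>Hitting times as series of killed transition operators\<close>

definition step_avg :: "'a pair_pre_digraph \<Rightarrow> ('a \<Rightarrow> ennreal) \<Rightarrow> 'a \<Rightarrow> ennreal" where
  "step_avg H g y = (\<integral>\<^sup>+z. g z \<partial>measure_pmf (pmf_of_set (parcs H `` {y})))"

text \<open>The transition operator of the walk killed at \<open>j\<close>, acting on functions of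
  the starting vertex. Values in \<open>ennreal\<close> let its powers be summed before finiteness
  is known.\<close>

definition killed_step :: "'a pair_pre_digraph \<Rightarrow> 'a \<Rightarrow> ('a \<Rightarrow> ennreal) \<Rightarrow> 'a \<Rightarrow> ennreal" where
  "killed_step H j g y = (if y = j then 0 else step_avg H g y)"

section \<open>Finite-dimensional laws of the walk\<close>

lemma sets_walk_measure [measurable_cong]:
  "sets (walk_measure H x) = sets (PiM UNIV (\<lambda>_. count_space UNIV))"
proof -
  interpret Ionescu_Tulcea "walk_kernel H x" "\<lambda>_. count_space UNIV"
    by (rule Ionescu_Tulcea_walk_kernel)
  show ?thesis
    unfolding walk_measure_def by (rule PF.sets_lim)
qed

text \<open>The one-step disintegration, transferred from the iterated kernels \<open>C\<close> to
  their projective limit. The restrictions are there because the kernels live on finite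
  products.\<close>

lemma nn_integral_walk_measure_Suc:
  fixes f :: "(nat \<Rightarrow> 'a) \<Rightarrow> ennreal"
  assumes f [measurable]: "f \<in> borel_measurable (PiM {0..<Suc n} (\<lambda>_. count_space UNIV))"
  shows "(\<integral>\<^sup>+\<omega>. f (restrict \<omega> {0..<Suc n}) \<partial>walk_measure H x) =
    (\<integral>\<^sup>+\<omega>. (\<integral>\<^sup>+y. f ((restrict \<omega> {0..<n})(n := y)) \<partial>walk_kernel H x n (restrict \<omega> {0..<n}))
       \<partial>walk_measure H x)"
proof -
  interpret Ionescu_Tulcea "walk_kernel H x" "\<lambda>_. count_space UNIV"
    by (rule Ionescu_Tulcea_walk_kernel)
  let ?M = "\<lambda>_::nat. count_space (UNIV :: 'a set)"
  have und: "(\<lambda>_. undefined) \<in> space (PiM {0..<0::nat} ?M)"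
    by (simp add: space_PiM)
  have lim_C: "(\<integral>\<^sup>+\<omega>. g (restrict \<omega> {0..<k}) \<partial>walk_measure H x) = (\<integral>\<^sup>+\<omega>. g \<omega> \<partial>C 0 k (\<lambda>_. undefined))"
    if g [measurable]: "g \<in> borel_measurable (PiM {0..<k} ?M)" for g :: "(nat \<Rightarrow> 'a) \<Rightarrow> ennreal" and k
  proof -
    \<comment> \<open>\<open>CI J\<close> comes from the iterated kernel up to the least strict
      upper bound of \<open>J\<close>.\<close>
    have up: "up_to {0..<k} = k"
    proof (rule antisym)
      show "up_to {0..<k} \<le> k"
        by (simp add: up_to_iff)
      show "k \<le> up_to {0..<k}"
        using up_to[of "{0..<k}"] by auto
    qed
    have "(\<integral>\<^sup>+\<omega>. g (restrict \<omega> {0..<k}) \<partial>walk_measure H x) = (\<integral>\<^sup>+\<omega>. g \<omega> \<partial>distr PF.lim (PiM {0..<k} ?M) (\<lambda>x. restrict x {0..<k}))"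
      unfolding walk_measure_def
      by (subst nn_integral_distr) (auto simp: measurable_cong_sets[OF PF.sets_lim] intro!: measurable_restrict)
    also have "\<dots> = (\<integral>\<^sup>+\<omega>. g \<omega> \<partial>CI {0..<k})"
      by (subst distr_lim) auto
    also have "\<dots> = (\<integral>\<^sup>+\<omega>. g (restrict \<omega> {0..<k}) \<partial>C 0 k (\<lambda>_. undefined))"
      unfolding CI_def up
      by (subst nn_integral_distr) (auto simp: measurable_cong_sets[OF sets_C[OF und]] intro!: measurable_restrict)
    also have "\<dots> = (\<integral>\<^sup>+\<omega>. g \<omega> \<partial>C 0 k (\<lambda>_. undefined))"
      by (intro nn_integral_cong) (auto simp: space_C[OF und] space_PiM)
    finally show ?thesis .
  qed
  have eq: "(\<integral>\<^sup>+y. f (fun_upd \<omega> n y) \<partial>walk_kernel H x n \<omega>) = (\<integral>\<^sup>+z. f z \<partial>eP n \<omega>)"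
    if "\<omega> \<in> space (PiM {0..<n} ?M)" for \<omega>
    using that by (simp add: nn_integral_eP)
  have "(\<integral>\<^sup>+\<omega>. f (restrict \<omega> {0..<Suc n}) \<partial>walk_measure H x) = (\<integral>\<^sup>+\<omega>. (\<integral>\<^sup>+z. f z \<partial>eP n \<omega>) \<partial>C 0 n (\<lambda>_. undefined))"
    using measurable_eP[of n]
    by (subst lim_C[OF f], simp)
       (subst nn_integral_bind[where B = "PiM {0..<Suc n} ?M"],
        simp_all add: measurable_cong_sets[OF sets_C[OF und]])
  also have "\<dots> = (\<integral>\<^sup>+\<omega>. (\<integral>\<^sup>+z. f z \<partial>eP n (restrict \<omega> {0..<n})) \<partial>walk_measure H x)"
    by (subst lim_C) (auto intro!: nn_integral_measurable_subprob_algebra2[OF _ measurable_eP] simp: measurable_split_conv)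
  also have "\<dots> = (\<integral>\<^sup>+\<omega>. (\<integral>\<^sup>+y. f ((restrict \<omega> {0..<n})(n := y)) \<partial>walk_kernel H x n (restrict \<omega> {0..<n})) \<partial>walk_measure H x)"
    by (intro nn_integral_cong eq[symmetric]) (simp add: space_PiM)
  finally show ?thesis .
qed

text \<open>Push-forward preserves total mass, and the image under projection to no coordinates is a
  probability measure.\<close>

lemma prob_space_walk_measure: "prob_space (walk_measure H x)"
proof -
  interpret Ionescu_Tulcea "walk_kernel H x" "\<lambda>_. count_space UNIV"
    by (rule Ionescu_Tulcea_walk_kernel)
  show ?thesis
    unfolding walk_measure_def
  proof (rule prob_space_distrD)
    show "(\<lambda>\<omega>. restrict \<omega> {}) \<in> PF.lim \<rightarrow>\<^sub>M PiM {} (\<lambda>_. count_space UNIV)"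
      by (simp add: measurable_cong_sets[OF PF.sets_lim] measurable_restrict)
    show "prob_space (distr PF.lim (PiM {} (\<lambda>_. count_space UNIV)) (\<lambda>\<omega>. restrict \<omega> {}))"
      by (simp add: distr_lim PF.prob_space_P)
  qed
qed

text \<open>The indicator is a finite product of functions of single coordinates.\<close>

lemma borel_measurable_indicator_avoid:
  fixes j :: 'a
  assumes "{..n} \<subseteq> I"
  shows "indicator {\<omega>. \<forall>k\<le>n. \<omega> k \<noteq> j} \<in> (borel_measurable (PiM I (\<lambda>_. count_space UNIV)) :: ((nat \<Rightarrow> 'a) \<Rightarrow> ennreal) set)"
proof -
  have "(\<lambda>\<omega>. \<Prod>k\<le>n. (if \<omega> k = j then 0 else 1 :: ennreal)) \<in>
      borel_measurable (PiM I (\<lambda>_. count_space UNIV))"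
  proof (rule borel_measurable_prod_ennreal)
    fix k assume "k \<in> {..n}"
    with assms have "(\<lambda>\<omega>. \<omega> k) \<in> PiM I (\<lambda>_. count_space UNIV) \<rightarrow>\<^sub>M count_space (UNIV :: 'a set)"
      by (intro measurable_component_singleton) auto
    then show "(\<lambda>\<omega>. if \<omega> k = j then 0 else 1 :: ennreal) \<in> borel_measurable (PiM I (\<lambda>_. count_space UNIV))"
      by (rule measurable_compose[where g = "\<lambda>y. if y = j then 0 else 1"]) simp
  qed
  also have "(\<lambda>\<omega>. \<Prod>k\<le>n. (if \<omega> k = j then 0 else 1 :: ennreal)) = indicator {\<omega>. \<forall>k\<le>n. \<omega> k \<noteq> j}"
    by (rule ext) (auto simp: indicator_def prod_zero_iff)
  finally show ?thesis .
qed

text \<open>Integrating out the last position replaces \<open>g\<close> by its one-step average,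
  after setting \<open>g\<close> to zero at \<open>j\<close>; hence the induction ranges over all
  \<open>g\<close>.\<close>

lemma nn_integral_walk_avoid:
  fixes g :: "'a \<Rightarrow> ennreal"
  shows "(\<integral>\<^sup>+\<omega>. indicator {\<omega>. \<forall>k\<le>n. \<omega> k \<noteq> j} \<omega> * g (\<omega> n) \<partial>walk_measure H x) =
    (killed_step H j ^^ n) (\<lambda>y. if y = j then 0 else g y) x"
proof (induction n arbitrary: g)
  case 0
  interpret prob_space "walk_measure H x"
    by (rule prob_space_walk_measure)
  let ?f = "\<lambda>\<omega>::nat \<Rightarrow> 'a. if \<omega> 0 = j then 0 else g (\<omega> 0)"
  have f: "?f \<in> borel_measurable (PiM {0..<Suc 0} (\<lambda>_. count_space UNIV))"
    by (rule measurable_compose[where f = "\<lambda>\<omega>. \<omega> 0" and N = "count_space UNIV"])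
       (auto intro: measurable_component_singleton)
  have "(\<integral>\<^sup>+\<omega>. indicator {\<omega>. \<forall>k\<le>0. \<omega> k \<noteq> j} \<omega> * g (\<omega> 0) \<partial>walk_measure H x) =
     (\<integral>\<^sup>+\<omega>. ?f (restrict \<omega> {0..<Suc 0}) \<partial>walk_measure H x)"
    by (intro nn_integral_cong) (auto split: split_indicator)
  also have "\<dots> = (\<integral>\<^sup>+\<omega>. (if x = j then 0 else g x) \<partial>walk_measure H x)"
    by (subst nn_integral_walk_measure_Suc[OF f]) (auto simp: walk_kernel_def)
  also have "\<dots> = (if x = j then 0 else g x)"
    by (simp add: emeasure_space_1)
  finally show ?case by simp
next
  case (Suc n)
  let ?M = "\<lambda>_::nat. count_space (UNIV :: 'a set)"
  let ?g = "\<lambda>y. if y = j then 0 else g y"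
  let ?A = "\<lambda>n. {\<omega>::nat \<Rightarrow> 'a. \<forall>k\<le>n. \<omega> k \<noteq> j}"
  let ?f = "\<lambda>\<omega>. indicator (?A n) \<omega> * ?g (\<omega> (Suc n))"
  have f: "?f \<in> borel_measurable (PiM {0..<Suc (Suc n)} ?M)"
  proof (rule borel_measurable_times_ennreal)
    show "(indicator (?A n) :: _ \<Rightarrow> ennreal) \<in> borel_measurable (PiM {0..<Suc (Suc n)} ?M)"
      by (rule borel_measurable_indicator_avoid) auto
    show "(\<lambda>\<omega>. ?g (\<omega> (Suc n))) \<in> borel_measurable (PiM {0..<Suc (Suc n)} ?M)"
      by (rule measurable_compose[where f = "\<lambda>\<omega>. \<omega> (Suc n)" and N = "count_space UNIV"])
         (auto intro: measurable_component_singleton)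
  qed
  have "(\<integral>\<^sup>+\<omega>. indicator (?A (Suc n)) \<omega> * g (\<omega> (Suc n)) \<partial>walk_measure H x) =
      (\<integral>\<^sup>+\<omega>. ?f (restrict \<omega> {0..<Suc (Suc n)}) \<partial>walk_measure H x)"
    by (intro nn_integral_cong) (auto simp: le_Suc_eq split: split_indicator)
  also have "\<dots> = (\<integral>\<^sup>+\<omega>. indicator (?A n) \<omega> * step_avg H ?g (\<omega> n) \<partial>walk_measure H x)"
    by (subst nn_integral_walk_measure_Suc[OF f], intro nn_integral_cong)
       (auto simp: walk_kernel_def step_avg_def split: split_indicator intro!: nn_integral_cong)
  also have "\<dots> = (killed_step H j ^^ n) (killed_step H j ?g) x"
    unfolding Suc by (simp add: killed_step_def[abs_def])
  finally show ?case
    by (simp add: funpow_swap1)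
qed

text \<open>The series counts the times \<open>n\<close> with no visit to \<open>j\<close> up to and
  including \<open>n\<close>. Without any visit it diverges, matching the infimum over the empty
  set.\<close>

lemma hitting_time_eq_suminf:
  "hitting_time j \<omega> = (\<Sum>n. indicator {\<omega>. \<forall>k\<le>n. \<omega> k \<noteq> j} \<omega>)"
proof (cases "\<exists>n. \<omega> n = j")
  case True
  define N where "N = (LEAST n. \<omega> n = j)"
  have N: "\<omega> N = j" "\<And>n. \<omega> n = j \<Longrightarrow> N \<le> n"
    using True by (auto simp: N_def intro: LeastI_ex Least_le)
  have "hitting_time j \<omega> = of_nat N"
    unfolding hitting_time_def using N by (intro antisym INF_lower INF_greatest) auto
  moreover have "(\<lambda>n. indicator {\<omega>. \<forall>k\<le>n. \<omega> k \<noteq> j} \<omega> :: ennreal) = (\<lambda>n. if n < N then 1 else 0)"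
  proof
    fix n show "indicator {\<omega>. \<forall>k\<le>n. \<omega> k \<noteq> j} \<omega> = (if n < N then 1 else 0 :: ennreal)"
      using N(1) N(2) by (auto simp: indicator_def not_less dest: leD) (meson N(2) le_trans not_le)
  qed
  moreover have "(\<Sum>n. if n < N then 1 else 0 :: ennreal) = of_nat N"
    by (subst suminf_finite[of "{..<N}"]) auto
  ultimately show ?thesis by simp
next
  case False
  then have "hitting_time j \<omega> = \<infinity>"
    by (auto simp: hitting_time_def)
  moreover have "(\<Sum>n. 1 :: ennreal) = \<infinity>"
    using summable_iff_suminf_neq_top[of "\<lambda>_. 1"] by (simp add: summable_const_iff)
  ultimately show ?thesis
    using False by simp
qed

text \<open>The tail-sum formula for an expectation: the terms are the probabilities that the
  hitting time exceeds \<open>n\<close>.\<close>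

lemma expected_hitting_time_eq_suminf:
  "expected_hitting_time H x j = (\<Sum>n. (killed_step H j ^^ n) (\<lambda>y. if y = j then 0 else 1) x)"
proof -
  have [measurable]: "indicator {\<omega>. \<forall>k\<le>n. \<omega> k \<noteq> j} \<in> borel_measurable (walk_measure H x)" for n
    by (simp add: measurable_cong_sets[OF sets_walk_measure] borel_measurable_indicator_avoid)
  have "expected_hitting_time H x j =
      (\<Sum>n. \<integral>\<^sup>+\<omega>. indicator {\<omega>. \<forall>k\<le>n. \<omega> k \<noteq> j} \<omega> \<partial>walk_measure H x)"
    unfolding expected_hitting_time_def hitting_time_eq_suminf
    by (rule nn_integral_suminf) measurable
  also have "\<dots> = (\<Sum>n. (killed_step H j ^^ n) (\<lambda>y. if y = j then 0 else 1) x)"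
    by (simp add: nn_integral_walk_avoid[where g = "\<lambda>_. 1" and j = j and H = H and x = x, simplified])
  finally show ?thesis .
qed

section \<open>Hitting times on connected graphs\<close>

definition nbrs :: "'a pair_pre_digraph \<Rightarrow> 'a \<Rightarrow> 'a set" where
  "nbrs H x = parcs H `` {x}"

definition deg :: "'a pair_pre_digraph \<Rightarrow> 'a \<Rightarrow> real" where
  "deg H x = real (card (nbrs H x))"

definition vol :: "'a pair_pre_digraph \<Rightarrow> real" where
  "vol H = (\<Sum>x\<in>pverts H. deg H x)"

text \<open>\<open>enn2real\<close> sends infinity to 0, so this is faithful only where the
  expectation is finite, as shown below for vertices of a \<open>walkable_graph\<close>.\<close>

definition mean_hit :: "'a pair_pre_digraph \<Rightarrow> 'a \<Rightarrow> 'a \<Rightarrow> real" where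
  "mean_hit H i j = enn2real (expected_hitting_time H i j)"

lemma mean_hit_nonneg: "0 \<le> mean_hit H i j"
  by (simp add: mean_hit_def)

text \<open>Stated directly on arcs so that \<open>G\<close> and its enlargements are all instances.
  Nonempty neighbourhoods make the uniform step meaningful.\<close>

locale walkable_graph =
  fixes H :: "'a pair_pre_digraph"
  assumes finite_verts: "finite (pverts H)"
    and arcs_subset: "parcs H \<subseteq> pverts H \<times> pverts H"
    and arcs_sym: "(x, y) \<in> parcs H \<Longrightarrow> (y, x) \<in> parcs H"
    and arcs_irrefl: "(x, x) \<notin> parcs H"
    and nbrs_nonempty: "x \<in> pverts H \<Longrightarrow> nbrs H x \<noteq> {}"
    and verts_nonempty: "pverts H \<noteq> {}"
    and reach: "x \<in> pverts H \<Longrightarrow> y \<in> pverts H \<Longrightarrow> (x, y) \<in> (parcs H)\<^sup>*"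
begin

section \<open>Counting arcs and edges\<close>

lemma nbrs_subset: "nbrs H x \<subseteq> pverts H"
  using arcs_subset by (auto simp: nbrs_def)

lemma nbrs_in_verts: "y \<in> nbrs H x \<Longrightarrow> y \<in> pverts H"
  using nbrs_subset by auto

lemma finite_nbrs: "finite (nbrs H x)"
  using finite_subset[OF nbrs_subset finite_verts] .

lemma deg_pos: "x \<in> pverts H \<Longrightarrow> 0 < deg H x"
  using nbrs_nonempty finite_nbrs by (auto simp: deg_def card_gt_0_iff)

lemma vol_pos: "0 < vol H"
  unfolding vol_def using deg_pos verts_nonempty finite_verts by (intro sum_pos) auto

lemma arcs_eq_Sigma: "parcs H = Sigma (pverts H) (nbrs H)"
  using arcs_subset by (auto simp: nbrs_def)

text \<open>Reversing arcs permutes the arc set: the adjacency operator is symmetric.\<close>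

lemma sum_nbrs_swap:
  fixes f :: "'a \<Rightarrow> 'a \<Rightarrow> 'b::comm_monoid_add"
  shows "(\<Sum>x\<in>pverts H. \<Sum>y\<in>nbrs H x. f x y) = (\<Sum>x\<in>pverts H. \<Sum>y\<in>nbrs H x. f y x)"
proof -
  have "(\<Sum>(x, y)\<in>parcs H. f x y) = (\<Sum>(x, y)\<in>parcs H. f y x)"
    by (rule sum.reindex_bij_witness[of _ prod.swap prod.swap]) (auto intro: arcs_sym)
  then show ?thesis
    unfolding arcs_eq_Sigma
    by (simp add: sum.Sigma[OF finite_verts] finite_nbrs)
qed

text \<open>The handshake lemma: without loops, each edge comes from exactly two arcs.\<close>

lemma vol_eq_uedges: "vol H = 2 * real (card (uedges H))"
proof -
  let ?e = "\<lambda>(x, y). {x, y}"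
  have fin: "finite (parcs H)"
    using finite_verts arcs_subset by (meson finite_SigmaI finite_subset)
  have fibre: "card {p. p \<in> parcs H \<and> ?e p = e} = 2" if e: "e \<in> ?e ` parcs H" for e
  proof -
    obtain x y where xy: "(x, y) \<in> parcs H" "e = {x, y}"
      using e by auto
    then have "{p. p \<in> parcs H \<and> ?e p = e} = {(x, y), (y, x)}"
      using arcs_sym by (auto simp: doubleton_eq_iff)
    moreover have "x \<noteq> y"
      using xy arcs_irrefl by auto
    ultimately show ?thesis
      by simp
  qed
  have "vol H = real (card (parcs H))"
    unfolding arcs_eq_Sigma vol_def deg_def
    by (subst card_SigmaI) (auto simp: finite_verts finite_nbrs)
  also have "card (parcs H) = (\<Sum>e\<in>?e ` parcs H. card {p. p \<in> parcs H \<and> ?e p = e})"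
    using sum.image_gen[OF fin, of "\<lambda>_. 1::nat" ?e] by simp
  also have "\<dots> = 2 * card (?e ` parcs H)"
    using fibre by simp
  also have "?e ` parcs H = uedges H"
    by (auto simp: uedges_def)
  finally show ?thesis
    by simp
qed

lemma stationary_eq: "stationary H x = deg H x / vol H"
proof -
  have "out_arcs (with_proj H) x = Pair x ` nbrs H x"
    by (auto simp: out_arcs_def nbrs_def)
  then have "out_degree (with_proj H) x = card (nbrs H x)"
    by (simp add: out_degree_def card_image inj_on_def)
  then show ?thesis
    by (simp add: stationary_def vol_eq_uedges deg_def)
qed

lemma step_avg_eq:
  assumes "x \<in> pverts H"
  shows "of_nat (card (nbrs H x)) * step_avg H g x = (\<Sum>y\<in>nbrs H x. g y)"
proof -
  have "step_avg H g x = (\<Sum>y\<in>nbrs H x. g y) / of_nat (card (nbrs H x))"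
    unfolding step_avg_def nbrs_def[symmetric]
    by (subst nn_integral_pmf_of_set) (auto simp: nbrs_nonempty[OF assms] finite_nbrs)
  then show ?thesis
    using deg_pos[OF assms]
    by (simp add: ennreal_times_divide deg_def mult.commute mult_divide_eq_ennreal)
qed

section \<open>First-step equations and finiteness\<close>

lemma expected_hitting_time_self: "expected_hitting_time H j j = 0"
proof -
  have "(killed_step H j ^^ n) (\<lambda>y. if y = j then 0 else 1) j = 0" for n
    by (cases n) (auto simp: killed_step_def)
  then show ?thesis
    by (simp add: expected_hitting_time_eq_suminf)
qed

text \<open>Term 0 of the series gives the 1, and the shifted tail commutes with averaging. Infinite
  values are allowed, so this can serve in the finiteness proof.\<close>

lemma expected_hitting_time_step:
  assumes "i \<noteq> j"
  shows "expected_hitting_time H i j = 1 + step_avg H (\<lambda>k. expected_hitting_time H k j) i"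
proof -
  let ?q = "\<lambda>n. (killed_step H j ^^ n) (\<lambda>y. if y = j then 0 else 1)"
  have "expected_hitting_time H i j = (\<Sum>n. ?q (n + 1) i) + (\<Sum>n<1. ?q n i)"
    unfolding expected_hitting_time_eq_suminf by (rule suminf_offset) simp
  also have "(\<Sum>n. ?q (n + 1) i) = (\<Sum>n. step_avg H (?q n) i)"
    using assms by (simp add: killed_step_def)
  also have "\<dots> = step_avg H (\<lambda>k. \<Sum>n. ?q n k) i"
    unfolding step_avg_def by (rule nn_integral_suminf[symmetric]) simp
  finally show ?thesis
    using assms by (simp add: expected_hitting_time_eq_suminf add.commute)
qed

text \<open>
  Weighting by the degrees, the walk killed at \<open>j\<close> loses at time \<open>n\<close> exactly the mass sitting on
  the neighbours of \<open>j\<close>, so the total time spent waiting there is bounded by the initial mass.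
\<close>

lemma sum_expected_hitting_time_nbrs_le:
  assumes j: "j \<in> pverts H"
  shows "(\<Sum>k\<in>nbrs H j. expected_hitting_time H k j) \<le> (\<Sum>i\<in>pverts H. of_nat (card (nbrs H i)))"
proof -
  define q where "q n = (killed_step H j ^^ n) (\<lambda>y. if y = j then 0 else 1)" for n
  define W where "W n = (\<Sum>i\<in>pverts H. of_nat (card (nbrs H i)) * q n i)" for n
  define B where "B n = (\<Sum>k\<in>nbrs H j. q n k)" for n
  \<comment> \<open>Killing removes from \<open>W (Suc n)\<close> exactly the row of
    \<open>j\<close>, which is \<open>B n\<close>. Once it is restored, reversing all arcs gives
    \<open>W n\<close>.\<close>
  have step: "B n + W (Suc n) = W n" for n
  proof -
    have "of_nat (card (nbrs H i)) * q (Suc n) i = (if i = j then 0 else \<Sum>k\<in>nbrs H i. q n k)"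
      if "i \<in> pverts H" for i
      using step_avg_eq[OF that, of "q n"] by (simp add: q_def killed_step_def)
    then have "W (Suc n) = (\<Sum>i\<in>pverts H. if i = j then 0 else \<Sum>k\<in>nbrs H i. q n k)"
      unfolding W_def by (intro sum.cong) auto
    also have "\<dots> = (\<Sum>i\<in>pverts H - {j}. \<Sum>k\<in>nbrs H i. q n k)"
      using finite_verts j by (subst sum.remove[OF _ j]) auto
    finally have "B n + W (Suc n) = (\<Sum>i\<in>pverts H. \<Sum>k\<in>nbrs H i. q n k)"
      unfolding B_def using sum.remove[OF finite_verts j, of "\<lambda>i. \<Sum>k\<in>nbrs H i. q n k"] by simp
    also have "\<dots> = (\<Sum>i\<in>pverts H. \<Sum>k\<in>nbrs H i. q n i)"
      by (rule sum_nbrs_swap)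
    also have "\<dots> = W n"
      by (simp add: W_def)
    finally show ?thesis .
  qed
  have "(\<Sum>n<m. B n) + W m = W 0" for m
  proof (induction m)
    case (Suc m)
    then show ?case
      using step[of m] by (simp add: add.assoc)
  qed simp
  then have "(\<Sum>n<m. B n) \<le> W 0" for m
    by (metis le_iff_add)
  then have "(\<Sum>n. B n) \<le> W 0"
    by (intro suminf_le_const) auto
  moreover have "(\<Sum>n. B n) = (\<Sum>k\<in>nbrs H j. expected_hitting_time H k j)"
    unfolding B_def expected_hitting_time_eq_suminf q_def by (rule suminf_sum) simp
  moreover have "W 0 \<le> (\<Sum>i\<in>pverts H. of_nat (card (nbrs H i)))"
    unfolding W_def q_def by (intro sum_mono) auto
  ultimately show ?thesis
    by simp
qed

text \<open>Finiteness spreads along a path starting at \<open>j\<close>. The mass bound covers the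
  neighbours of \<open>j\<close>; elsewhere a finite value forces a finite average over the
  neighbours, hence finite values at each of them.\<close>

lemma expected_hitting_time_finite:
  assumes i: "i \<in> pverts H" and j: "j \<in> pverts H"
  shows "expected_hitting_time H i j < top"
  using reach[OF j i] i
proof (induction rule: rtrancl_induct)
  case base
  then show ?case by (simp add: expected_hitting_time_self)
next
  case (step y z)
  have y: "y \<in> pverts H" and z: "z \<in> nbrs H y"
    using step arcs_subset by (auto simp: nbrs_def)
  have "(\<Sum>k\<in>nbrs H y. expected_hitting_time H k j) < top"
  proof (cases "y = j")
    case True
    have "(\<Sum>k\<in>nbrs H j. expected_hitting_time H k j) \<le> (\<Sum>i\<in>pverts H. of_nat (card (nbrs H i)))"
      by (rule sum_expected_hitting_time_nbrs_le[OF j])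
    also have "\<dots> < top"
      using finite_verts by (simp add: less_top[symmetric])
    finally show ?thesis
      using True by simp
  next
    case False
    have "step_avg H (\<lambda>k. expected_hitting_time H k j) y < top"
      using step.IH[OF y] expected_hitting_time_step[OF False] by (simp add: less_top)
    then have "of_nat (card (nbrs H y)) * step_avg H (\<lambda>k. expected_hitting_time H k j) y < top"
      by (simp add: ennreal_mult_less_top of_nat_less_top)
    then show ?thesis
      by (simp only: step_avg_eq[OF y])
  qed
  then show ?case
    using z finite_nbrs by (simp add: less_top)
qed

lemma ennreal_mean_hit:
  "i \<in> pverts H \<Longrightarrow> j \<in> pverts H \<Longrightarrow> ennreal (mean_hit H i j) = expected_hitting_time H i j"
  using expected_hitting_time_finite by (simp add: mean_hit_def)

lemma mean_hit_self: "mean_hit H j j = 0"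
  by (simp add: mean_hit_def expected_hitting_time_self)

lemma mean_hit_step:
  assumes i: "i \<in> pverts H" and j: "j \<in> pverts H" and "i \<noteq> j"
  shows "deg H i * mean_hit H i j = deg H i + (\<Sum>k\<in>nbrs H i. mean_hit H k j)"
proof -
  have "ennreal (deg H i * mean_hit H i j) = of_nat (card (nbrs H i)) * expected_hitting_time H i j"
    using ennreal_mean_hit[OF i j] mean_hit_nonneg[of H i j]
    by (simp add: deg_def ennreal_mult ennreal_of_nat_eq_real_of_nat)
  also have "\<dots> = of_nat (card (nbrs H i)) +
      of_nat (card (nbrs H i)) * step_avg H (\<lambda>k. expected_hitting_time H k j) i"
    using expected_hitting_time_step[OF \<open>i \<noteq> j\<close>] by (simp add: distrib_left)
  also have "\<dots> = of_nat (card (nbrs H i)) + (\<Sum>k\<in>nbrs H i. ennreal (mean_hit H k j))"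
    unfolding step_avg_eq[OF i] by (simp add: ennreal_mean_hit nbrs_in_verts j)
  also have "\<dots> = ennreal (deg H i + (\<Sum>k\<in>nbrs H i. mean_hit H k j))"
    by (simp add: mean_hit_nonneg deg_def ennreal_of_nat_eq_real_of_nat sum_nonneg flip: ennreal_plus)
  finally show ?thesis
    using mean_hit_nonneg[of H]
    by (subst (asm) ennreal_inj) (auto simp: deg_def intro!: sum_nonneg add_nonneg_nonneg)
qed

text \<open>Kac's formula: the mean return time to \<open>j\<close> is
  \<open>vol H / deg H j\<close>. Summing the first-step equations over all \<open>i\<close> other
  than \<open>j\<close> and reversing arcs leaves only this row.\<close>

lemma sum_mean_hit_nbrs:
  assumes j: "j \<in> pverts H"
  shows "(\<Sum>k\<in>nbrs H j. mean_hit H k j) = vol H - deg H j"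
proof -
  let ?t = "\<lambda>i. mean_hit H i j"
  have "(\<Sum>i\<in>pverts H. \<Sum>k\<in>nbrs H i. ?t k) = (\<Sum>i\<in>pverts H. \<Sum>k\<in>nbrs H i. ?t i)"
    by (rule sum_nbrs_swap)
  also have "\<dots> = (\<Sum>i\<in>pverts H. deg H i * ?t i)"
    by (simp add: deg_def)
  also have "\<dots> = (\<Sum>i\<in>pverts H - {j}. deg H i * ?t i)"
    using sum.remove[OF finite_verts j, of "\<lambda>i. deg H i * ?t i"] by (simp add: mean_hit_self)
  also have "\<dots> = (\<Sum>i\<in>pverts H - {j}. deg H i + (\<Sum>k\<in>nbrs H i. ?t k))"
    using j by (intro sum.cong) (auto simp: mean_hit_step)
  also have "\<dots> = (vol H - deg H j) + (\<Sum>i\<in>pverts H - {j}. \<Sum>k\<in>nbrs H i. ?t k)"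
    unfolding vol_def using sum.remove[OF finite_verts j, of "deg H"] by (simp add: sum.distrib)
  finally show ?thesis
    using sum.remove[OF finite_verts j, of "\<lambda>i. \<Sum>k\<in>nbrs H i. ?t k"] by simp
qed

lemma mean_hit_laplacian:
  assumes "i \<in> pverts H" "j \<in> pverts H"
  shows "deg H i * mean_hit H i j =
    deg H i + (\<Sum>k\<in>nbrs H i. mean_hit H k j) - (if i = j then vol H else 0)"
  using assms mean_hit_step[of i j] sum_mean_hit_nbrs[of j] by (auto simp: mean_hit_self)

text \<open>The maximum principle with one exceptional vertex: a maximum spreads along a path
  towards \<open>j\<close>.\<close>

lemma harmonic_le:
  fixes f :: "'a \<Rightarrow> real"
  assumes harm: "\<And>i. i \<in> pverts H \<Longrightarrow> i \<noteq> j \<Longrightarrow> deg H i * f i = (\<Sum>k\<in>nbrs H i. f k)"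
    and j: "j \<in> pverts H" and x: "x \<in> pverts H"
  shows "f x \<le> f j"
proof -
  obtain i where i: "i \<in> pverts H" and max: "\<And>y. y \<in> pverts H \<Longrightarrow> f y \<le> f i"
  proof -
    have "Max (f ` pverts H) \<in> f ` pverts H"
      using finite_verts verts_nonempty by (intro Max_in) auto
    then obtain i where "i \<in> pverts H" "f i = Max (f ` pverts H)"
      by auto
    then show ?thesis
      using finite_verts by (intro that[of i]) auto
  qed
  \<comment> \<open>The second disjunct covers paths that have already passed through
    \<open>j\<close>, where harmonicity is not assumed.\<close>
  have "f y = f i \<or> f j = f i" if "(i, y) \<in> (parcs H)\<^sup>*" for y
    using that
  proof (induction rule: rtrancl_induct)
    case base
    then show ?case by simp
  next
    case (step y z)
    have y: "y \<in> pverts H" and z: "z \<in> nbrs H y"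
      using step arcs_subset by (auto simp: nbrs_def)
    show ?case
    proof (cases "y = j \<or> f j = f i")
      case True
      then show ?thesis using step.IH by auto
    next
      case False
      then have "f y = f i"
        using step.IH by auto
      then have "(\<Sum>k\<in>nbrs H y. f i - f k) = 0"
        using harm[OF y] False by (simp add: sum_subtractf deg_def)
      then have "\<forall>k\<in>nbrs H y. f i - f k = 0"
        using max nbrs_in_verts finite_nbrs by (subst (asm) sum_nonneg_eq_0_iff) auto
      then show ?thesis
        using z by auto
    qed
  qed
  from this[OF reach[OF i j]] max[OF x] show ?thesis
    by auto
qed

lemma harmonic_const:
  fixes f :: "'a \<Rightarrow> real"
  assumes harm: "\<And>i. i \<in> pverts H \<Longrightarrow> i \<noteq> j \<Longrightarrow> deg H i * f i = (\<Sum>k\<in>nbrs H i. f k)"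
    and j: "j \<in> pverts H" and x: "x \<in> pverts H"
  shows "f x = f j"
  using harmonic_le[OF harm j x] harmonic_le[of j "\<lambda>y. - f y", OF _ j x] harm
  by (force simp: sum_negf)

text \<open>The difference of two solutions is harmonic off \<open>j\<close>. Hitting times in the
  enlarged graphs are then found by checking a candidate.\<close>

lemma mean_hit_unique:
  assumes zero: "f j = 0"
    and f: "\<And>i. i \<in> pverts H \<Longrightarrow> i \<noteq> j \<Longrightarrow> deg H i * f i = deg H i + (\<Sum>k\<in>nbrs H i. f k)"
    and j: "j \<in> pverts H" and x: "x \<in> pverts H"
  shows "mean_hit H x j = f x"
proof -
  have "mean_hit H x j - f x = mean_hit H j j - f j"
    by (rule harmonic_const[OF _ j x])
       (simp add: f mean_hit_step j right_diff_distrib sum_subtractf)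
  then show ?thesis
    by (simp add: zero mean_hit_self)
qed

text \<open>In the weighted average of the Laplacian equations, the total
  \<open>vol H * deg H i\<close> cancels against the point term from the target \<open>i\<close>.
  The average is therefore harmonic everywhere, hence constant, and any start vertex may be
  used.\<close>

lemma kemeny_eq:
  assumes x: "x \<in> pverts H"
  shows "kemeny H = ennreal ((\<Sum>j\<in>pverts H. deg H j * mean_hit H x j) / vol H)"
proof -
  define \<kappa> where "\<kappa> i = (\<Sum>j\<in>pverts H. deg H j * mean_hit H i j)" for i
  have "deg H i * \<kappa> i = (\<Sum>k\<in>nbrs H i. \<kappa> k)" if i: "i \<in> pverts H" for i
  proof -
    have "deg H i * \<kappa> i = (\<Sum>j\<in>pverts H. deg H j * (deg H i * mean_hit H i j))"
      by (simp add: \<kappa>_def sum_distrib_left ac_simps)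
    also have "\<dots> = (\<Sum>j\<in>pverts H. deg H j * deg H i + (\<Sum>k\<in>nbrs H i. deg H j * mean_hit H k j)
        - (if i = j then deg H j * vol H else 0))"
      by (intro sum.cong) (auto simp: mean_hit_laplacian i algebra_simps sum_distrib_left)
    also have "\<dots> = vol H * deg H i + (\<Sum>j\<in>pverts H. \<Sum>k\<in>nbrs H i. deg H j * mean_hit H k j)
        - deg H i * vol H"
      using i finite_verts
      by (simp add: sum_subtractf sum.distrib vol_def sum_distrib_right)
    also have "\<dots> = (\<Sum>k\<in>nbrs H i. \<kappa> k)"
      unfolding \<kappa>_def by (subst sum.swap) simp
    finally show ?thesis .
  qed
  then have const: "\<kappa> i = \<kappa> x" if "i \<in> pverts H" for i
    by (intro harmonic_const[OF _ x that]) auto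
  have "(\<Sum>j\<in>pverts H. ennreal (stationary H j) * expected_hitting_time H i j) = ennreal (\<kappa> x / vol H)"
    if i: "i \<in> pverts H" for i
  proof -
    have "(\<Sum>j\<in>pverts H. ennreal (stationary H j) * expected_hitting_time H i j) =
        (\<Sum>j\<in>pverts H. ennreal (deg H j * mean_hit H i j / vol H))"
    proof (intro sum.cong refl)
      fix j assume j: "j \<in> pverts H"
      have "ennreal (stationary H j) * expected_hitting_time H i j =
          ennreal (stationary H j * mean_hit H i j)"
        unfolding ennreal_mean_hit[OF i j, symmetric]
        by (rule ennreal_mult''[symmetric]) (rule mean_hit_nonneg)
      then show "ennreal (stationary H j) * expected_hitting_time H i j =
          ennreal (deg H j * mean_hit H i j / vol H)"
        by (simp add: stationary_eq)
    qed
    also have "\<dots> = ennreal (\<kappa> i / vol H)"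
      using deg_pos vol_pos
      by (subst sum_ennreal) (auto simp: \<kappa>_def sum_divide_distrib mean_hit_nonneg less_imp_le)
    finally show ?thesis
      by (simp add: const[OF i])
  qed
  then show ?thesis
    unfolding kemeny_def \<kappa>_def[symmetric] using x by (intro the_equality) auto
qed

end

section \<open>Attaching a cone at a vertex\<close>

text \<open>
  \<open>H\<close> is \<open>G\<close> with a cone over the graph \<open>(W, R)\<close> attached, whose apex is the vertex \<open>v\<close> of \<open>G\<close>.
\<close>

locale cone_attached = walkable_graph G for G :: "'a pair_pre_digraph" +
  fixes H :: "'a pair_pre_digraph" and v :: 'a and W :: "'a set" and R :: "('a \<times> 'a) set"
  assumes apex: "v \<in> pverts G"
    and finite_base: "finite W"
    and base_disjoint: "pverts G \<inter> W = {}"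
    and base_arcs: "R \<subseteq> W \<times> W" "sym R" "irrefl R"
    and verts_H: "pverts H = pverts G \<union> W"
    and arcs_H: "parcs H = parcs G \<union> {v} \<times> W \<union> W \<times> {v} \<union> R"
begin

lemma nbrs_H_apex: "nbrs H v = nbrs G v \<union> W"
  using apex base_disjoint base_arcs by (auto simp: nbrs_def arcs_H)

lemma nbrs_H_other: "x \<in> pverts G \<Longrightarrow> x \<noteq> v \<Longrightarrow> nbrs H x = nbrs G x"
  using base_disjoint base_arcs by (auto simp: nbrs_def arcs_H)

lemma nbrs_H_base: "w \<in> W \<Longrightarrow> nbrs H w = insert v (R `` {w})"
  using apex base_disjoint base_arcs arcs_subset by (auto simp: nbrs_def arcs_H)

sublocale H: walkable_graph H
proof
  show "finite (pverts H)"
    using finite_verts finite_base by (simp add: verts_H)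
  show "parcs H \<subseteq> pverts H \<times> pverts H"
    using arcs_subset apex base_arcs by (auto simp: verts_H arcs_H)
  show "(y, x) \<in> parcs H" if "(x, y) \<in> parcs H" for x y
    using that arcs_sym base_arcs(2) by (auto simp: arcs_H dest: symD)
  show "(x, x) \<notin> parcs H" for x
    using arcs_irrefl apex base_disjoint base_arcs(3) by (auto simp: arcs_H irrefl_def)
  show "pverts H \<noteq> {}"
    using verts_nonempty by (simp add: verts_H)
  show "nbrs H x \<noteq> {}" if "x \<in> pverts H" for x
    using that nbrs_nonempty by (cases "x = v") (auto simp: verts_H nbrs_H_apex nbrs_H_other nbrs_H_base)
  have sub: "(parcs G)\<^sup>* \<subseteq> (parcs H)\<^sup>*"
    by (rule rtrancl_mono) (auto simp: arcs_H)
  \<comment> \<open>Paths are routed through the apex, which is adjacent to all of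
    \<open>W\<close>.\<close>
  have "(x, v) \<in> (parcs H)\<^sup>* \<and> (v, x) \<in> (parcs H)\<^sup>*" if "x \<in> pverts H" for x
  proof (cases "x \<in> pverts G")
    case True
    then show ?thesis
      using reach[OF True apex] reach[OF apex True] sub by auto
  next
    case False
    then have "x \<in> W"
      using that by (simp add: verts_H)
    then have "(x, v) \<in> parcs H" "(v, x) \<in> parcs H"
      by (auto simp: arcs_H)
    then show ?thesis
      by blast
  qed
  then show "(x, y) \<in> (parcs H)\<^sup>*" if "x \<in> pverts H" "y \<in> pverts H" for x y
    using that rtrancl_trans by metis
qed

lemma nbrs_apex_disjoint: "nbrs G v \<inter> W = {}"
  using nbrs_subset base_disjoint by auto

lemma sum_nbrs_H_apex: "(\<Sum>k\<in>nbrs H v. f k) = (\<Sum>k\<in>nbrs G v. f k) + (\<Sum>k\<in>W. f k)"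
  unfolding nbrs_H_apex using finite_nbrs finite_base nbrs_apex_disjoint by (rule sum.union_disjoint)

lemma deg_H_apex: "deg H v = deg G v + card W"
  unfolding deg_def nbrs_H_apex using finite_nbrs finite_base nbrs_apex_disjoint
  by (simp add: card_Un_disjoint)

lemma deg_H_other: "x \<in> pverts G \<Longrightarrow> x \<noteq> v \<Longrightarrow> deg H x = deg G x"
  by (simp add: deg_def nbrs_H_other)

lemma sum_deg_H:
  fixes f :: "'a \<Rightarrow> real"
  shows "(\<Sum>x\<in>pverts H. deg H x * f x) =
    (\<Sum>x\<in>pverts G. deg G x * f x) + card W * f v + (\<Sum>w\<in>W. deg H w * f w)"
proof -
  have "(\<Sum>x\<in>pverts G. deg H x * f x) = (\<Sum>x\<in>pverts G. deg G x * f x) + card W * f v"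
    using sum.remove[OF finite_verts apex, of "\<lambda>x. deg G x * f x"]
      sum.remove[OF finite_verts apex, of "\<lambda>x. deg H x * f x"]
    by (simp add: deg_H_apex deg_H_other algebra_simps)
  then show ?thesis
    using sum.union_disjoint[OF finite_verts finite_base base_disjoint, of "\<lambda>x. deg H x * f x"]
    by (simp add: verts_H)
qed

text \<open>
  A potential \<open>g\<close> with \<open>g j = 0\<close> whose Laplacian is \<open>1\<close> at \<open>v\<close>, \<open>-1\<close> at \<open>j\<close> and \<open>0\<close> elsewhere is
  \<open>(mean_hit G i j - mean_hit G i v + mean_hit G j v) / vol G\<close>. The cone returns every visitor
  to \<open>v\<close> and therefore acts on the walk in \<open>G\<close> as a source of strength \<open>\<mu>\<close> at \<open>v\<close>.
\<close>

lemma mean_hit_H_old: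
  fixes s :: "'a \<Rightarrow> real"
  assumes s: "\<And>w. w \<in> W \<Longrightarrow> deg H w * s w = deg H w + (\<Sum>k\<in>R `` {w}. s k)"
    and \<mu>: "\<mu> = card W + (\<Sum>w\<in>W. s w)"
    and j: "j \<in> pverts G"
  shows "mean_hit H v j = mean_hit G v j + \<mu> * (mean_hit G v j + mean_hit G j v) / vol G"
proof -
  define t where "t = mean_hit G"
  define g where "g i = (t i j - t i v + t j v) / vol G" for i
  \<comment> \<open>By its equations, \<open>s\<close> is the expected time to reach the apex from
    the base, so a base vertex gets the value at \<open>v\<close> plus \<open>s\<close>.\<close>
  define f where "f i = (if i \<in> W then t v j + \<mu> * g v + s i else t i j + \<mu> * g i)" for i
  have vW: "v \<notin> W" and jW: "j \<notin> W"
    using base_disjoint apex j by auto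
  have G_notin_W: "x \<notin> W" if "x \<in> pverts G" for x
    using that base_disjoint by auto
  \<comment> \<open>Subtracting the Laplacian equations for targets \<open>j\<close> and
    \<open>v\<close> cancels the degrees and leaves the two point sources.\<close>
  have g_lap: "deg G i * g i - (\<Sum>k\<in>nbrs G i. g k) = (if i = v then 1 else 0) - (if i = j then 1 else 0)"
    if i: "i \<in> pverts G" for i
  proof -
    have "deg G i * g i - (\<Sum>k\<in>nbrs G i. g k) =
        ((deg G i * t i j - (\<Sum>k\<in>nbrs G i. t k j)) - (deg G i * t i v - (\<Sum>k\<in>nbrs G i. t k v))) / vol G"
      unfolding g_def sum_divide_distrib[symmetric] using vol_pos
      by (simp add: sum.distrib sum_subtractf deg_def field_simps)
    also have "\<dots> = ((if i = v then vol G else 0) - (if i = j then vol G else 0)) / vol G"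
      unfolding t_def by (simp add: mean_hit_laplacian i j apex)
    finally show ?thesis
      using vol_pos by auto
  qed
  have f_nbrs: "(\<Sum>k\<in>nbrs G i. f k) = (\<Sum>k\<in>nbrs G i. t k j) + \<mu> * (\<Sum>k\<in>nbrs G i. g k)" for i
  proof -
    have "(\<Sum>k\<in>nbrs G i. f k) = (\<Sum>k\<in>nbrs G i. t k j + \<mu> * g k)"
      by (intro sum.cong refl) (auto simp: f_def dest: nbrs_in_verts G_notin_W)
    then show ?thesis
      by (simp add: sum.distrib sum_distrib_left)
  qed
  \<comment> \<open>Only neighbours in \<open>G\<close> are counted here; the surplus
    \<open>\<mu>\<close> at \<open>v\<close> is what the arcs into \<open>W\<close> account
    for.\<close>
  have f_old: "deg G i * f i = deg G i + (\<Sum>k\<in>nbrs G i. f k) + (if i = v then \<mu> else 0)"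
    if i: "i \<in> pverts G" "i \<noteq> j" for i
  proof -
    have "deg G i * f i = deg G i * t i j + \<mu> * (deg G i * g i)"
      using G_notin_W[OF i(1)] by (simp add: f_def algebra_simps)
    also have "\<dots> = deg G i + (\<Sum>k\<in>nbrs G i. t k j) + \<mu> * ((\<Sum>k\<in>nbrs G i. g k) + (if i = v then 1 else 0))"
      using g_lap[OF i(1)] mean_hit_step[OF i(1) j i(2)] i(2) by (simp add: t_def algebra_simps)
    finally show ?thesis
      by (simp add: f_nbrs algebra_simps)
  qed
  have "mean_hit H v j = f v"
  proof (rule H.mean_hit_unique)
    show "f j = 0"
      using jW by (simp add: f_def g_def t_def mean_hit_self)
    show "j \<in> pverts H" "v \<in> pverts H"
      using j apex by (auto simp: verts_H)
    fix i assume i: "i \<in> pverts H" "i \<noteq> j"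
    show "deg H i * f i = deg H i + (\<Sum>k\<in>nbrs H i. f k)"
    proof (cases "i \<in> W")
      case True
      have RW: "R `` {i} \<subseteq> W" "finite (R `` {i})" "v \<notin> R `` {i}"
        using base_arcs(1) finite_subset[of "R `` {i}", OF _ finite_base] vW by auto
      have "(\<Sum>k\<in>R `` {i}. f k) = card (R `` {i}) * f v + (\<Sum>k\<in>R `` {i}. s k)"
      proof -
        have "(\<Sum>k\<in>R `` {i}. f k) = (\<Sum>k\<in>R `` {i}. f v + s k)"
          using RW vW by (intro sum.cong refl) (auto simp: f_def)
        then show ?thesis
          by (simp add: sum.distrib)
      qed
      moreover have "deg H i = 1 + card (R `` {i})"
        using RW by (simp add: deg_def nbrs_H_base[OF True] del: Image_singleton_iff)
      moreover have "(\<Sum>k\<in>nbrs H i. f k) = f v + (\<Sum>k\<in>R `` {i}. f k)"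
        using RW by (simp add: nbrs_H_base[OF True] del: Image_singleton_iff)
      moreover have "f i = f v + s i"
        using True vW by (simp add: f_def)
      ultimately show ?thesis
        using s[OF True] by (simp add: algebra_simps)
    next
      case False
      then have iG: "i \<in> pverts G"
        using i by (simp add: verts_H)
      show ?thesis
      proof (cases "i = v")
        case True
        have "(\<Sum>k\<in>W. f k) = card W * f v + (\<Sum>w\<in>W. s w)"
          using vW by (simp add: f_def sum.distrib)
        then show ?thesis
          using f_old[OF iG i(2)] True \<mu>
          by (simp add: sum_nbrs_H_apex deg_H_apex algebra_simps)
      next
        case False
        then show ?thesis
          using f_old[OF iG i(2)] iG by (simp add: nbrs_H_other deg_H_other)
      qed
    qed
  qed
  then show ?thesis
    using vW by (simp add: f_def g_def t_def mean_hit_self)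
qed

text \<open>From \<open>G\<close> the walk must pass \<open>v\<close> before it reaches
  \<open>W\<close>, so old vertices get \<open>F\<close> plus their hitting time of \<open>v\<close>
  in \<open>G\<close>. By Kac's formula at \<open>v\<close>, \<open>G\<close> enters the remaining
  system only through \<open>vol G\<close>.\<close>

lemma mean_hit_H_new:
  fixes f :: "'a \<Rightarrow> real" and F :: real
  assumes j: "j \<in> W" and zero: "f j = 0"
    and f_apex: "card W * F = card W + vol G + (\<Sum>w\<in>W. f w)"
    and f_base: "\<And>w. w \<in> W \<Longrightarrow> w \<noteq> j \<Longrightarrow> deg H w * f w = deg H w + F + (\<Sum>k\<in>R `` {w}. f k)"
  shows "mean_hit H v j = F"
proof -
  define f' where "f' i = (if i \<in> W then f i else F + mean_hit G i v)" for i
  have vW: "v \<notin> W"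
    using base_disjoint apex by auto
  have G_notin_W: "x \<notin> W" if "x \<in> pverts G" for x
    using that base_disjoint by auto
  have f'_nbrs: "(\<Sum>k\<in>nbrs G i. f' k) = deg G i * F + (\<Sum>k\<in>nbrs G i. mean_hit G k v)" for i
  proof -
    have "(\<Sum>k\<in>nbrs G i. f' k) = (\<Sum>k\<in>nbrs G i. F + mean_hit G k v)"
      by (intro sum.cong refl) (auto simp: f'_def dest: nbrs_in_verts G_notin_W)
    then show ?thesis
      by (simp add: sum.distrib deg_def)
  qed
  have "mean_hit H v j = f' v"
  proof (rule H.mean_hit_unique)
    show "f' j = 0"
      using j zero by (simp add: f'_def)
    show "j \<in> pverts H" "v \<in> pverts H"
      using j apex by (auto simp: verts_H)
    fix i assume i: "i \<in> pverts H" "i \<noteq> j"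
    show "deg H i * f' i = deg H i + (\<Sum>k\<in>nbrs H i. f' k)"
    proof (cases "i \<in> W")
      case True
      have RW: "R `` {i} \<subseteq> W" "finite (R `` {i})" "v \<notin> R `` {i}"
        using base_arcs(1) finite_subset[of "R `` {i}", OF _ finite_base] vW by auto
      have "(\<Sum>k\<in>R `` {i}. f' k) = (\<Sum>k\<in>R `` {i}. f k)"
        using RW by (intro sum.cong) (auto simp: f'_def)
      moreover have "(\<Sum>k\<in>nbrs H i. f' k) = f' v + (\<Sum>k\<in>R `` {i}. f' k)"
        using RW by (simp add: nbrs_H_base[OF True] del: Image_singleton_iff)
      ultimately show ?thesis
        using f_base[OF True i(2)] True vW by (simp add: f'_def mean_hit_self)
    next
      case False
      then have iG: "i \<in> pverts G"
        using i by (simp add: verts_H)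
      show ?thesis
      proof (cases "i = v")
        case True
        have "(\<Sum>k\<in>W. f' k) = (\<Sum>w\<in>W. f w)"
          by (simp add: f'_def)
        then show ?thesis
          using f_apex f'_nbrs[of v] sum_mean_hit_nbrs[OF apex] True vW
          by (simp add: sum_nbrs_H_apex deg_H_apex f'_def mean_hit_self algebra_simps)
      next
        case False
        then show ?thesis
          using mean_hit_step[OF iG apex] f'_nbrs[of i] G_notin_W[OF iG] iG
          by (simp add: nbrs_H_other deg_H_other f'_def algebra_simps)
      qed
    qed
  qed
  then show ?thesis
    using vW by (simp add: f'_def mean_hit_self)
qed

text \<open>The source strength \<open>\<mu>\<close> is also the gain in volume, so the constant of
  \<open>G\<close> splits off as a separate summand. \<open>\<Phi>\<close> collects the new
  targets.\<close>

lemma kemeny_H: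
  fixes s :: "'a \<Rightarrow> real"
  assumes s: "\<And>w. w \<in> W \<Longrightarrow> deg H w * s w = deg H w + (\<Sum>k\<in>R `` {w}. s k)"
    and sum_s: "(\<Sum>w\<in>W. s w) = (\<Sum>w\<in>W. deg H w)"
    and \<mu>: "\<mu> = card W + (\<Sum>w\<in>W. deg H w)"
    and \<Phi>: "\<Phi> = (\<Sum>w\<in>W. deg H w * mean_hit H v w)"
  shows "kemeny H = ennreal ((\<Sum>j\<in>pverts G. deg G j * mean_hit G v j) / vol G +
    (\<mu> * (\<Sum>j\<in>pverts G. deg G j * mean_hit G j v) / vol G + \<Phi>) / (vol G + \<mu>))"
proof -
  define X where "X = (\<Sum>j\<in>pverts G. deg G j * mean_hit G v j)"
  define Y where "Y = (\<Sum>j\<in>pverts G. deg G j * mean_hit G j v)"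
  have \<mu>_nonneg: "\<mu> \<ge> 0"
    by (simp add: \<mu> deg_def sum_nonneg)
  have vol: "vol H = vol G + \<mu>"
    using sum_deg_H[of "\<lambda>_. 1"] by (simp add: vol_def \<mu>)
  have "(\<Sum>j\<in>pverts G. deg G j * mean_hit H v j) =
      (\<Sum>j\<in>pverts G. deg G j * mean_hit G v j +
        \<mu> / vol G * (deg G j * mean_hit G v j + deg G j * mean_hit G j v))"
    using mean_hit_H_old[OF s, of \<mu>] sum_s
    by (intro sum.cong) (simp_all add: \<mu> field_simps)
  also have "\<dots> = X + \<mu> / vol G * (X + Y)"
    by (simp only: sum.distrib sum_distrib_left[symmetric] X_def Y_def)
  finally have "(\<Sum>j\<in>pverts H. deg H j * mean_hit H v j) = X + \<mu> / vol G * (X + Y) + \<Phi>"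
    by (simp add: sum_deg_H H.mean_hit_self \<Phi>)
  moreover have "v \<in> pverts H"
    using apex by (simp add: verts_H)
  ultimately have "kemeny H = ennreal ((X + \<mu> / vol G * (X + Y) + \<Phi>) / (vol G + \<mu>))"
    using H.kemeny_eq[of v] by (simp add: vol)
  also have "(X + \<mu> / vol G * (X + Y) + \<Phi>) / (vol G + \<mu>) = X / vol G + (\<mu> * Y / vol G + \<Phi>) / (vol G + \<mu>)"
  proof -
    have "vol G + \<mu> > 0" "vol G > 0"
      using vol_pos \<mu>_nonneg by auto
    then show ?thesis
      by (simp add: divide_simps) (simp add: algebra_simps)
  qed
  finally show ?thesis
    by (simp add: X_def Y_def)
qed

end

section \<open>Three pendants against a fan\<close>

text \<open>With symmetric arcs, connectedness gives directed paths. An edge supplies a second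
  vertex, and the first arc of a path to another vertex gives a neighbour.\<close>

lemma walkable_graphI:
  assumes "pair_graph G" and conn: "Digraph_Component.connected (with_proj G)"
    and edge: "card (uedges G) \<ge> 1"
  shows "walkable_graph G"
proof -
  interpret pair_graph G by fact
  have "strongly_connected (with_proj G)"
    using symmetric_connected_imp_strongly_connected[OF pair_sym_arcs conn] .
  then have reach: "(x, y) \<in> (parcs G)\<^sup>*" if "x \<in> pverts G" "y \<in> pverts G" for x y
    using that by (auto simp: strongly_connected_def reachable_conv)
  obtain p q where pq: "(p, q) \<in> parcs G"
    using edge by (cases "uedges G = {}") (auto simp: uedges_def)
  then have pq': "p \<in> pverts G" "q \<in> pverts G" "p \<noteq> q"
    using in_arcsD1 in_arcsD2 no_loops'[OF pq] by auto
  show ?thesis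
  proof
    show "nbrs G x \<noteq> {}" if "x \<in> pverts G" for x
    proof -
      obtain y where "y \<in> pverts G" "y \<noteq> x"
        using pq' by (cases "p = x") auto
      with reach[OF that] show ?thesis
        by (auto simp: nbrs_def elim: converse_rtranclE)
    qed
    show "(y, x) \<in> parcs G" if "(x, y) \<in> parcs G" for x y
      using that pair_sym_arcs by (auto simp: symmetric_def dest: symD)
    show "(x, x) \<notin> parcs G" for x
      using no_loops' by blast
  qed (use pair_finite_verts in_arcsD1 in_arcsD2 pq' reach in auto)
qed

theorem theorem4p15:
  fixes G Gbar Ghat :: "'a pair_pre_digraph" and v a b c :: 'a
  assumes "pair_graph G"
    and "Digraph_Component.connected (with_proj G)"
    and "card (uedges G) \<ge> 1"
    and "v \<in> pverts G"
    and "a \<notin> pverts G" and "b \<notin> pverts G" and "c \<notin> pverts G"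
    and "distinct [a, b, c]"
    and "Gbar = attach_pendant (attach_pendant (attach_pendant G v a) v b) v c"
    and "Ghat = add_edge (add_edge Gbar a b) b c"
  shows "kemeny Ghat > kemeny Gbar"
proof -
  have abc: "a \<noteq> b" "a \<noteq> c" "b \<noteq> c" "b \<noteq> a" "c \<noteq> a" "c \<noteq> b"
    using assms(8) by auto
  have v_new: "v \<noteq> a" "v \<noteq> b" "v \<noteq> c"
    using assms(4-7) by auto
  interpret walkable_graph G
    using assms(1-3) by (rule walkable_graphI)
  \<comment> \<open>The pendants form a cone over three isolated points; the added edges turn the
    base into the path \<open>a\<close>, \<open>b\<close>, \<open>c\<close>.\<close>
  interpret bar: cone_attached G Gbar v "{a, b, c}" "{}"
    by unfold_locales
       (use assms(4-9) in \<open>auto simp: attach_pendant_def add_edge_def sym_def irrefl_def\<close>)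
  let ?R = "{(a, b), (b, a), (b, c), (c, b)}"
  interpret hat: cone_attached G Ghat v "{a, b, c}" ?R
    by unfold_locales
       (use assms(4-10) in \<open>auto simp: attach_pendant_def add_edge_def sym_def irrefl_def\<close>)
  define D where "D = vol G"
  define Y where "Y = (\<Sum>j\<in>pverts G. deg G j * mean_hit G j v)"
  define X where "X = (\<Sum>j\<in>pverts G. deg G j * mean_hit G v j)"

  have deg_bar: "deg Gbar w = 1" if "w \<in> {a, b, c}" for w
    using that by (simp add: deg_def bar.nbrs_H_base)
  \<comment> \<open>Another leaf needs one step to \<open>v\<close>, so it has value
    \<open>F + 1\<close>; then \<open>3 * F = 3 + D + 2 * (F + 1)\<close> gives
    \<open>F = D + 5\<close>.\<close>
  have hit_bar: "mean_hit Gbar v w = D + 5" if "w \<in> {a, b, c}" for w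
    by (rule bar.mean_hit_H_new[where f = "\<lambda>x. if x = w then 0 else D + 6"])
       (use that abc deg_bar in \<open>auto simp: D_def\<close>)
  have bar: "kemeny Gbar = ennreal (X / D + (6 * Y / D + 3 * (D + 5)) / (D + 6))"
    unfolding X_def Y_def D_def
    by (rule bar.kemeny_H[where s = "\<lambda>_. 1"]) (use abc deg_bar hit_bar in \<open>auto simp: D_def\<close>)

  have R_img: "?R `` {a} = {b}" "?R `` {b} = {a, c}" "?R `` {c} = {b}"
    using abc by auto
  have deg_hat: "deg Ghat a = 2" "deg Ghat b = 3" "deg Ghat c = 2"
    using abc v_new by (simp_all add: deg_def hat.nbrs_H_base R_img)

  txt \<open>The witnesses solve the linear system on \<open>{v, a, b, c}\<close> for the respective target.\<close>
  have hit_a: "mean_hit Ghat v a = 4 + 5 * D / 8"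
    by (rule hat.mean_hit_H_new[where
          f = "\<lambda>x. if x = a then 0 else if x = b then (8 + 3 * (4 + 5 * D / 8)) / 5
                 else (9 + 4 * (4 + 5 * D / 8)) / 5"])
       (use abc in \<open>auto simp: D_def deg_hat R_img field_simps\<close>)
  have hit_c: "mean_hit Ghat v c = 4 + 5 * D / 8"
    by (rule hat.mean_hit_H_new[where
          f = "\<lambda>x. if x = c then 0 else if x = b then (8 + 3 * (4 + 5 * D / 8)) / 5
                 else (9 + 4 * (4 + 5 * D / 8)) / 5"])
       (use abc in \<open>auto simp: D_def deg_hat R_img field_simps\<close>)
  \<comment> \<open>By symmetry \<open>a\<close> and \<open>c\<close> share the value
    \<open>1 + F / 2\<close>.\<close>
  have hit_b: "mean_hit Ghat v b = (D + 5) / 2"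
    by (rule hat.mean_hit_H_new[where f = "\<lambda>x. if x = b then 0 else 1 + (D + 5) / 4"])
       (use abc in \<open>auto simp: D_def deg_hat R_img field_simps\<close>)
  \<comment> \<open>Here \<open>s\<close> solves \<open>2 * s a = 2 + s b\<close> and
    \<open>3 * s b = 3 + 2 * s a\<close>, with \<open>s c = s a\<close>. Its sum is 7, so
    \<open>\<mu> = 10\<close>.\<close>
  have hat: "kemeny Ghat = ennreal (X / D + (10 * Y / D + (47 / 2 + 4 * D)) / (D + 10))"
    unfolding X_def Y_def D_def
    by (rule hat.kemeny_H[where s = "\<lambda>x. if x = b then 5 / 2 else 9 / 4"])
       (use abc in \<open>auto simp: D_def deg_hat R_img hit_a hit_b hit_c field_simps\<close>)

  have D_ge: "D \<ge> 2"
    using assms(3) by (simp add: D_def vol_eq_uedges)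
  have X_nonneg: "X \<ge> 0"
    unfolding X_def by (intro sum_nonneg mult_nonneg_nonneg) (auto simp: deg_def mean_hit_nonneg)
  \<comment> \<open>A neighbour of \<open>v\<close> has hitting time at least 1.\<close>
  have Y_pos: "Y > 0"
  proof -
    obtain k where k: "k \<in> nbrs G v"
      using nbrs_nonempty[OF assms(4)] by auto
    then have kG: "k \<in> pverts G" and "k \<noteq> v"
      using nbrs_in_verts arcs_irrefl by (auto simp: nbrs_def)
    then have "deg G k * mean_hit G k v \<ge> deg G k"
      using mean_hit_step[OF kG assms(4)] by (simp add: sum_nonneg mean_hit_nonneg)
    then have "0 < deg G k * mean_hit G k v"
      using deg_pos[OF kG] by linarith
    then show ?thesis
      unfolding Y_def using kG finite_verts
      by (intro sum_pos2[of _ k]) (auto simp: deg_def mean_hit_nonneg)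
  qed
  have "(6 * Y / D + 3 * (D + 5)) / (D + 6) < (10 * Y / D + (47 / 2 + 4 * D)) / (D + 10)"
  proof -
    define y where "y = Y / D"
    have "y > 0"
      using Y_pos D_ge by (simp add: y_def)
    then have "D * y > 0"
      using D_ge by simp
    moreover have "(D - 2) * (D + 9 / 2) \<ge> 0"
      using D_ge by simp
    moreover have "(10 * y + (47 / 2 + 4 * D)) * (D + 6) - (6 * y + 3 * (D + 5)) * (D + 10) =
        4 * (D * y) + (D - 2) * (D + 9 / 2)"
      by (simp add: field_simps)
    ultimately have "(6 * y + 3 * (D + 5)) * (D + 10) < (10 * y + (47 / 2 + 4 * D)) * (D + 6)"
      by linarith
    moreover have "p / q < r / s" if "p * s < r * q" "0 < q" "0 < s" for p q r s :: real
      using that by (simp add: field_simps)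
    ultimately have "(6 * y + 3 * (D + 5)) / (D + 6) < (10 * y + (47 / 2 + 4 * D)) / (D + 10)"
      using D_ge by simp
    then show ?thesis
      by (simp add: y_def)
  qed
  \<comment> \<open>\<open>ennreal\<close> truncates negative reals to 0; nonnegativity of the
    smaller side keeps the inequality strict.\<close>
  moreover have "0 \<le> X / D + (6 * Y / D + 3 * (D + 5)) / (D + 6)"
    using X_nonneg Y_pos D_ge by (intro add_nonneg_nonneg divide_nonneg_nonneg) auto
  ultimately show ?thesis
    unfolding bar hat by (simp add: ennreal_less_iff)
qed

end
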